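(* Let $\varphi:S^1\to S^1$ be an orientation preserving homeomorphism with $\varrho(\varphi)=\frac{p}{q}$. Then for every $\varepsilon>0$ there exists $N$ such that for every $z\in S^1$ the sequence $\{\eta_n(z)\}_{n=-\infty}^{\infty}$ satisfies at least one of the following statements: (1) $\forall_{n>N}\ \forall_{l\in\mathbb{N}}\ |\eta_{n+lq}(z)-\eta_n(z)|<\varepsilon$; or (2) $\forall_{n>N}\ \forall_{l\in\mathbb{N}}\ |\eta_{-(n+lq)}(z)-\eta_{-n}(z)|<\varepsilon$.
   Context: $S^1$ is the unit circle, covered by $\mathbb{R}$ via $x\mapsto\exp(2\pi\mathrm{i}x)$. For a lift $\Phi:\mathbb{R}\to\mathbb{R}$ of $\varphi$, the rotation number is $\varrho(\varphi)=\lim_{n\to\infty}\Phi^n(x)/n\bmod 1$. The displacement sequence of $z=\exp(2\pi\mathrm{i}x)$ is $\eta_n(z)=\Phi^n(x)-\Phi^{n-1}(x)\bmod 1\in[0,1)$, here for all $n\in\mathbb{Z}$; it does not depend on the choice of lift. *)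

theory Defs
  imports "HOL-Analysis.Analysis"
begin

definition circle_cover :: "real \<Rightarrow> complex" where
  "circle_cover x = exp (2 * of_real pi * \<i> * of_real x)"

definition is_lift :: "(complex \<Rightarrow> complex) \<Rightarrow> (real \<Rightarrow> real) \<Rightarrow> bool" where
  "is_lift \<phi> \<Phi> \<longleftrightarrow>
     continuous_on UNIV \<Phi> \<and> (\<forall>x. circle_cover (\<Phi> x) = \<phi> (circle_cover x))"

text \<open>Circle maps are functions on the complex plane of which only the values on
  the unit circle matter. A circle homeomorphism preserves orientation iff it has a
  strictly increasing lift; all its lifts, which differ by integer constants, are then
  strictly increasing.\<close>

definition orientation_preserving_circle_homeo :: "(complex \<Rightarrow> complex) \<Rightarrow> bool" where
  "orientation_preserving_circle_homeo \<phi> \<longleftrightarrow>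
     (\<exists>\<psi>. homeomorphism (sphere 0 1) (sphere 0 1) \<phi> \<psi>) \<and>
     (\<exists>\<Phi>. is_lift \<phi> \<Phi> \<and> strict_mono \<Phi>)"

text \<open>For an orientation preserving circle homeomorphism, the descriptions below
  determine their values uniquely: the lift and the point over the circle
  can be chosen arbitrarily. The residue mod 1 is represented in \<open>[0,1)\<close> by \<^const>\<open>frac\<close>.\<close>

definition rotation_number :: "(complex \<Rightarrow> complex) \<Rightarrow> real" where
  "rotation_number \<phi> =
     (THE r. \<exists>\<Phi> x L. is_lift \<phi> \<Phi> \<and> (\<lambda>n. (\<Phi> ^^ n) x / real n) \<longlonglongrightarrow> L \<and> r = frac L)"

definition int_iterate :: "('a \<Rightarrow> 'a) \<Rightarrow> int \<Rightarrow> 'a \<Rightarrow> 'a" where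
  "int_iterate f n = (if n \<ge> 0 then f ^^ nat n else inv f ^^ nat (- n))"

definition displacement :: "(complex \<Rightarrow> complex) \<Rightarrow> int \<Rightarrow> complex \<Rightarrow> real" where
  "displacement \<phi> n z =
     (THE r. \<exists>\<Phi> x. is_lift \<phi> \<Phi> \<and> z = circle_cover x \<and>
        r = frac (int_iterate \<Phi> n x - int_iterate \<Phi> (n - 1) x))"

end

theory Submission
  imports Defs
begin

text \<open>
  Let \<open>\<Phi>\<close> be an increasing lift and \<open>X\<close> the two-sided orbit of a point under \<open>\<Phi>\<close>. The
  displacements are the fractional parts of the steps \<open>X n - X (n - 1)\<close>, and all steps of one
  orbit have the same integer part (\<open>orbit_floor_step\<close>). Differences of displacements are
  therefore differences of steps, and it is enough to show that
  \<open>X (n + l q) - X n - l p\<close> is small for late times \<open>n\<close>, or for early ones, uniformly in the orbit.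

  The translation number \<open>p / q\<close> of \<open>\<Phi>\<close> gives \<open>F = \<Phi>\<^sup>q - p\<close> translation number 0. A map with that
  translation number has a fixed point, since otherwise its orbits would drift linearly
  (\<open>zero_translation_number_fixed_point\<close>). All orbits of \<open>F\<close> are thus monotone and bounded. How
  fast they converge depends on the orbit, and no time works for all orbits in one prescribed
  direction: an orbit may linger near its repelling end for as long as one likes. But then its
  past is already close to that end. An orbit which is far from convergence both in the past and
  in the future stays away from the fixed points in between, where \<open>F\<close> moves points by
  at least a constant, and this can last only for a bounded time
  (\<open>orbit_settles_forward_or_backward\<close>). Uniform continuity of \<open>\<Phi>, \<dots>, \<Phi>\<^sup>q\<close> carries
  the dichotomy over from \<open>F\<close> to \<open>\<Phi>\<close> (\<open>orbit_almost_periodic_forward_or_backward\<close>).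
\<close>

section \<open>Lifts of degree one and their orbits\<close>

locale degree_one_lift =
  fixes \<Phi> :: "real \<Rightarrow> real"
  assumes cont: "continuous_on UNIV \<Phi>"
    and smono: "strict_mono \<Phi>"
    and shift_one: "\<Phi> (x + 1) = \<Phi> x + 1"

text \<open>Two-sided orbits are treated as sequences satisfying the recursion. In this form, passing to
  every \<open>q\<close>-th point, or to another lift, needs no computation with powers of inverse maps.\<close>

definition is_orbit :: "('a \<Rightarrow> 'a) \<Rightarrow> (int \<Rightarrow> 'a) \<Rightarrow> bool" where
  "is_orbit f X \<longleftrightarrow> (\<forall>i. X (i + 1) = f (X i))"

lemma shift_invariant_constant:
  fixes f :: "int \<Rightarrow> 'a"
  assumes "\<And>i. f (i + 1) = f i"
  shows "f i = f j"
proof -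
  have "f i = f 0" for i
  proof (induction i rule: int_induct[where k = 0])
    case (step2 i)
    then show ?case using assms[of "i - 1"] by simp
  qed (auto simp: assms)
  then show ?thesis by metis
qed

lemma orbit_iterate:
  assumes "is_orbit f X"
  shows "X (i + int n) = (f ^^ n) (X i)"
proof (induction n)
  case (Suc n)
  have "X (i + int (Suc n)) = X (i + int n + 1)" by (simp add: algebra_simps)
  then show ?case using assms Suc by (simp add: is_orbit_def)
qed simp

lemma orbit_unique:
  assumes "is_orbit f X" "is_orbit f Y" "inj f" "X 0 = Y 0"
  shows "X = Y"
proof -
  have "(X (i + 1) = Y (i + 1)) = (X i = Y i)" for i
    using assms by (auto simp: is_orbit_def inj_eq)
  from shift_invariant_constant[of "\<lambda>i. X i = Y i", OF this] assms(4)
  show ?thesis by blast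
qed

lemma int_iterate_orbit:
  assumes "bij f"
  shows "is_orbit f (\<lambda>i. int_iterate f i x)"
  unfolding is_orbit_def
proof
  fix i :: int
  show "int_iterate f (i + 1) x = f (int_iterate f i x)"
  proof (cases "i \<ge> 0")
    case True
    then have "nat (i + 1) = Suc (nat i)" by simp
    then show ?thesis using True by (simp add: int_iterate_def)
  next
    case False
    then obtain n where n: "i = - int (Suc n)"
      by (metis int_cases not_le of_nat_0_le_iff)
    have "f (inv f y) = y" for y
      using assms by (simp add: bij_is_surj surj_f_inv_f)
    moreover have "nat (- i) = Suc n" "i + 1 = - int n" using n by auto
    ultimately show ?thesis using False
      by (auto simp: int_iterate_def)
  qed
qed

context degree_one_lift
begin

lemma mono_le: "x \<le> y \<Longrightarrow> \<Phi> x \<le> \<Phi> y"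
  using smono strict_mono_less_eq by blast

lemma shift_int: "\<Phi> (x + of_int m) = \<Phi> x + of_int m"
proof -
  have "\<Phi> (x + of_int (i + 1)) - of_int (i + 1) = \<Phi> (x + of_int i) - of_int i" for i
    using shift_one[of "x + of_int i"] by (simp add: algebra_simps)
  from shift_invariant_constant[of "\<lambda>i. \<Phi> (x + of_int i) - of_int i", OF this, of m 0]
  show ?thesis by simp
qed

lemma iterate: "degree_one_lift (\<Phi> ^^ n)"
proof
  show "continuous_on UNIV (\<Phi> ^^ n)"
  proof (induction n)
    case (Suc n)
    then show ?case
      using continuous_on_compose[OF Suc continuous_on_subset[OF cont]] by simp
  qed (simp add: continuous_on_id)
  show "strict_mono (\<Phi> ^^ n)"
  proof (induction n)
    case (Suc n)
    then show ?case using smono by (simp add: strict_mono_def)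
  qed (simp add: strict_mono_def)
  show "(\<Phi> ^^ n) (x + 1) = (\<Phi> ^^ n) x + 1" for x
    by (induction n) (auto simp: shift_one)
qed

lemma translate: "degree_one_lift (\<lambda>x. \<Phi> x + c)"
proof
  show "continuous_on UNIV (\<lambda>x. \<Phi> x + c)"
    by (intro continuous_intros cont)
  show "strict_mono (\<lambda>x. \<Phi> x + c)" using smono by (simp add: strict_mono_def)
  show "\<Phi> (x + 1) + c = \<Phi> x + c + 1" for x by (simp add: shift_one)
qed

lemma bijective: "bij \<Phi>"
proof -
  have "surj \<Phi>"
  proof (rule surjI)
    fix y
    let ?m = "\<lfloor>y - \<Phi> 0\<rfloor>"
    have "\<Phi> (of_int ?m) = \<Phi> 0 + of_int ?m" "\<Phi> (of_int ?m + 1) = \<Phi> 0 + of_int ?m + 1"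
      using shift_int[of 0 ?m] shift_one[of "of_int ?m"] by auto
    moreover have "\<Phi> 0 + of_int ?m \<le> y" "y \<le> \<Phi> 0 + of_int ?m + 1" by linarith+
    ultimately have "\<exists>x. of_int ?m \<le> x \<and> x \<le> of_int ?m + 1 \<and> \<Phi> x = y"
      by (intro IVT') (auto intro: continuous_on_subset[OF cont])
    then show "\<Phi> (SOME x. \<Phi> x = y) = y" by (metis (mono_tags, lifting) someI_ex)
  qed
  then show ?thesis using smono strict_mono_imp_inj_on bij_def by blast
qed

text \<open>The displacement has period 1, and over one period both \<open>\<Phi>\<close> and the identity grow by
  exactly 1.\<close>

lemma displacement_oscillation: "\<bar>(\<Phi> x - x) - (\<Phi> y - y)\<bar> \<le> 1"
proof -
  let ?m = "\<lfloor>x - y\<rfloor>"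
  have "y + of_int ?m \<le> x" "x \<le> y + of_int (?m + 1)" by linarith+
  then have "\<Phi> y + of_int ?m \<le> \<Phi> x" "\<Phi> x \<le> \<Phi> y + of_int (?m + 1)"
    using mono_le shift_int by metis+
  then show ?thesis by linarith
qed

text \<open>Monotonicity carries the inequality \<open>x + m \<le> \<Phi> x\<close> from \<open>x\<close> to \<open>\<Phi> x\<close> and back. So an
  orbit never sees the jumps of \<^const>\<open>frac\<close>: differences of displacements modulo 1
  along an orbit are genuine differences of real numbers.\<close>

lemma orbit_floor_step:
  assumes "is_orbit \<Phi> X"
  shows "\<lfloor>X (i + 1) - X i\<rfloor> = \<lfloor>X (j + 1) - X j\<rfloor>"
proof -
  have "\<lfloor>X (i + 1 + 1) - X (i + 1)\<rfloor> = \<lfloor>X (i + 1) - X i\<rfloor>" for i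
  proof -
    let ?m = "\<lfloor>X (i + 1) - X i\<rfloor>"
    have "X i + of_int ?m \<le> X (i + 1)" "X (i + 1) < X i + of_int (?m + 1)" by linarith+
    then have "\<Phi> (X i + of_int ?m) \<le> \<Phi> (X (i + 1))"
      "\<Phi> (X (i + 1)) < \<Phi> (X i + of_int (?m + 1))"
      using mono_le strict_monoD[OF smono] by auto
    moreover have "\<Phi> (X i) = X (i + 1)" "\<Phi> (X (i + 1)) = X (i + 1 + 1)"
      using assms unfolding is_orbit_def by metis+
    ultimately have "X (i + 1) + of_int ?m \<le> X (i + 1 + 1)"
      "X (i + 1 + 1) < X (i + 1) + of_int (?m + 1)"
      by (simp_all only: shift_int)
    then show ?thesis by (intro floor_unique) linarith+
  qed
  from shift_invariant_constant[of "\<lambda>i. \<lfloor>X (i + 1) - X i\<rfloor>", OF this]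
  show ?thesis .
qed

lemma orbit_monotone:
  assumes "is_orbit \<Phi> X"
  shows "mono X \<or> antimono X"
proof (cases "X 1 \<ge> X 0")
  case True
  have step: "X i \<le> X (i + 1)" for i
  proof -
    have "0 \<le> \<lfloor>X (i + 1) - X i\<rfloor>" using orbit_floor_step[OF assms, of i 0] True by simp
    then show ?thesis by simp
  qed
  have "X i \<le> X j" if "i \<le> j" for i j
    using that by (induction j rule: int_ge_induct) (auto intro: order_trans[OF _ step] order_trans[OF step])
  then show ?thesis by (auto simp: mono_def)
next
  case False
  have step: "X (i + 1) \<le> X i" for i
  proof -
    have "\<lfloor>X (i + 1) - X i\<rfloor> < 0" using orbit_floor_step[OF assms, of i 0] False by simp
    then show ?thesis by simp
  qed
  have "X j \<le> X i" if "i \<le> j" for i j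
    using that by (induction j rule: int_ge_induct) (auto intro: order_trans[OF _ step] order_trans[OF step])
  then show ?thesis by (auto simp: antimono_def)
qed

lemma orbit_side_of_fixed_point:
  assumes "is_orbit \<Phi> X" "\<Phi> w = w"
  shows "X i < w \<longleftrightarrow> X j < w" and "w < X i \<longleftrightarrow> w < X j"
proof -
  have "(X (i + 1) < w) = (X i < w)" "(w < X (i + 1)) = (w < X i)" for i
    using assms strict_mono_less[OF smono] unfolding is_orbit_def by metis+
  from shift_invariant_constant[of "\<lambda>i. X i < w", OF this(1)]
    shift_invariant_constant[of "\<lambda>i. w < X i", OF this(2)]
  show "X i < w \<longleftrightarrow> X j < w" "w < X i \<longleftrightarrow> w < X j" by blast+
qed

section \<open>Quantitative dynamics of a lift with a fixed point\<close>

text \<open>By periodicity it suffices to look at \<open>[0, 1]\<close>, where the points at distance at least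
  \<open>\<delta>\<close> from all fixed points form a compact set on which the displacement does not vanish.\<close>

lemma small_displacement_near_fixed_point:
  assumes "\<delta> > 0"
  shows "\<exists>c>0. \<forall>y. \<bar>\<Phi> y - y\<bar> < c \<longrightarrow> (\<exists>w. \<Phi> w = w \<and> \<bar>w - y\<bar> < \<delta>)"
proof -
  define S where "S = {0..1} \<inter> (\<Inter>w\<in>{w. \<Phi> w = w}. {y. \<delta> \<le> \<bar>w - y\<bar>})"
  have "closed {y. \<delta> \<le> \<bar>w - y\<bar>}" for w :: real
    by (intro closed_Collect_le continuous_intros)
  then have compact: "compact S" unfolding S_def
    by (intro compact_Int_closed closed_INT) auto
  have nz: "\<bar>\<Phi> y - y\<bar> > 0" if "y \<in> S" for y
    using that assms by (auto simp: S_def)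
  have "\<exists>c>0. \<forall>y\<in>S. c \<le> \<bar>\<Phi> y - y\<bar>"
  proof (cases "S = {}")
    case False
    have "continuous_on S (\<lambda>y. \<bar>\<Phi> y - y\<bar>)"
      by (intro continuous_intros continuous_on_subset[OF cont]) auto
    from continuous_attains_inf[OF compact False this] nz show ?thesis by metis
  qed (auto intro: exI[of _ 1])
  then obtain c where c: "c > 0" "\<And>y. y \<in> S \<Longrightarrow> c \<le> \<bar>\<Phi> y - y\<bar>" by blast
  have "\<exists>w. \<Phi> w = w \<and> \<bar>w - y\<bar> < \<delta>" if "\<bar>\<Phi> y - y\<bar> < c" for y
  proof -
    have "\<Phi> (frac y) - frac y = \<Phi> y - y"
      using shift_int[of y "- \<lfloor>y\<rfloor>"] by (simp add: frac_def)
    then have "frac y \<notin> S" using c(2) that by fastforce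
    then obtain w where w: "\<Phi> w = w" "\<bar>w - frac y\<bar> < \<delta>"
      by (auto simp: S_def frac_lt_1 less_imp_le not_le)
    have "\<Phi> (w + of_int \<lfloor>y\<rfloor>) = w + of_int \<lfloor>y\<rfloor>" using w(1) shift_int by simp
    moreover have "\<bar>w + of_int \<lfloor>y\<rfloor> - y\<bar> < \<delta>" using w(2) by (simp add: frac_def algebra_simps)
    ultimately show ?thesis by blast
  qed
  with c(1) show ?thesis by blast
qed

text \<open>An orbit is monotone and trapped between two fixed points at distance 1. If it still had
  to travel \<open>\<delta>\<close> after time \<open>K\<close> and had already travelled \<open>\<delta>\<close> before time 0, then throughout
  the times \<open>0, \<dots>, K\<close> it would be \<open>\<delta>\<close>-far from every fixed point. Each of these \<open>K\<close> steps
  would have length at least the constant \<open>c\<close> of the previous lemma, which depends on \<open>\<delta>\<close> only,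
  and \<open>K\<close> is chosen with \<open>K c > 1\<close>, which is too far to go.\<close>

lemma orbit_settles_forward_or_backward:
  assumes fp: "\<Phi> w0 = w0" and "\<delta> > 0"
  shows "\<exists>K::nat. \<forall>Y. is_orbit \<Phi> Y \<longrightarrow>
    (\<forall>k\<ge>int K. \<forall>l::nat. \<bar>Y (k + int l) - Y k\<bar> < \<delta>) \<or>
    (\<forall>k\<le>0. \<forall>l::nat. \<bar>Y (k - int l) - Y k\<bar> < \<delta>)"
proof -
  from small_displacement_near_fixed_point[OF \<open>\<delta> > 0\<close>] obtain c where
    c: "c > 0" "\<And>y. \<bar>\<Phi> y - y\<bar> < c \<Longrightarrow> \<exists>w. \<Phi> w = w \<and> \<bar>w - y\<bar> < \<delta>" by blast
  obtain K :: nat where K: "1 / c < real K" using reals_Archimedean2 by blast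
  then have Kc: "1 < real K * c" using c(1) by (simp add: field_simps)
  have False if Y: "is_orbit \<Phi> Y" and "k \<ge> int K" "k' \<le> 0"
    and late: "\<bar>Y (k + int l) - Y k\<bar> \<ge> \<delta>" and early: "\<bar>Y (k' - int l') - Y k'\<bar> \<ge> \<delta>"
    for Y k l k' l'
  proof -
    have big_step: "c \<le> \<bar>Y (j + 1) - Y j\<bar>" if "0 \<le> j" "j \<le> int K" for j
    proof (rule ccontr)
      assume "\<not> ?thesis"
      then obtain w where w: "\<Phi> w = w" "\<bar>w - Y j\<bar> < \<delta>"
        using c(2)[of "Y j"] Y by (auto simp: is_orbit_def)
      note side = orbit_side_of_fixed_point[OF Y w(1)]
      have ord: "k' - int l' \<le> k'" "k' \<le> j" "j \<le> k" "k \<le> k + int l"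
        using that \<open>k \<ge> int K\<close> \<open>k' \<le> 0\<close> by auto
      from orbit_monotone[OF Y] show False
      proof
        assume "mono Y"
        from ord[THEN monoD[OF this]] late early w(2)
        have "Y (k' - int l') < w" "w < Y (k + int l)" by linarith+
        then show False using side(1)[of "k' - int l'" "k + int l"] by linarith
      next
        assume "antimono Y"
        from ord[THEN antimonoD[OF this]] late early w(2)
        have "w < Y (k' - int l')" "Y (k + int l) < w" by linarith+
        then show False using side(1)[of "k' - int l'" "k + int l"] by linarith
      qed
    qed
    have travelled: "real n * c \<le> \<bar>Y (int n) - Y 0\<bar>" if "n \<le> K" for n
      using that
    proof (induction n)
      case (Suc n)
      have IH: "real n * c \<le> \<bar>Y (int n) - Y 0\<bar>" and st: "c \<le> \<bar>Y (int n + 1) - Y (int n)\<bar>"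
        using Suc big_step by auto
      have "\<bar>Y (int n + 1) - Y 0\<bar> = \<bar>Y (int n) - Y 0\<bar> + \<bar>Y (int n + 1) - Y (int n)\<bar>"
        using orbit_monotone[OF Y]
      proof
        assume "mono Y"
        from monoD[OF this, of 0 "int n"] monoD[OF this, of "int n" "int n + 1"]
        show ?thesis by simp
      next
        assume "antimono Y"
        from antimonoD[OF this, of 0 "int n"] antimonoD[OF this, of "int n" "int n + 1"]
        show ?thesis by simp
      qed
      with IH st show ?case by (simp add: algebra_simps)
    qed simp
    let ?w = "w0 + of_int \<lfloor>Y 0 - w0\<rfloor>"
    have w: "\<Phi> ?w = ?w" "\<Phi> (?w + 1) = ?w + 1" using fp shift_int shift_one by auto
    have "?w \<le> Y 0" "Y 0 < ?w + 1" by linarith+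
    then have "?w \<le> Y (int K)" "Y (int K) < ?w + 1"
      using orbit_side_of_fixed_point(1)[OF Y w(1), of 0 "int K"]
        orbit_side_of_fixed_point(1)[OF Y w(2), of 0 "int K"] by linarith+
    with \<open>?w \<le> Y 0\<close> \<open>Y 0 < ?w + 1\<close> have "\<bar>Y (int K) - Y 0\<bar> < 1" by linarith
    with travelled[of K] Kc show False by simp
  qed
  then show ?thesis by (intro exI[of _ K]) (meson not_le)
qed

lemma iterates_equicontinuous:
  assumes "\<epsilon> > 0"
  shows "\<exists>\<delta>>0. \<forall>r\<le>R. \<forall>u v. \<bar>u - v\<bar> < \<delta> \<longrightarrow> \<bar>(\<Phi> ^^ r) u - (\<Phi> ^^ r) v\<bar> < \<epsilon>"
proof (induction R)
  case 0
  then show ?case using assms by auto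
next
  case (Suc R)
  then obtain \<delta> where \<delta>: "\<delta> > 0"
    "\<And>r u v. r \<le> R \<Longrightarrow> \<bar>u - v\<bar> < \<delta> \<Longrightarrow> \<bar>(\<Phi> ^^ r) u - (\<Phi> ^^ r) v\<bar> < \<epsilon>" by blast
  interpret it: degree_one_lift "\<Phi> ^^ Suc R" by (rule iterate)
  have "uniformly_continuous_on {-1..2} (\<Phi> ^^ Suc R)"
    by (intro compact_uniformly_continuous continuous_on_subset[OF it.cont]) auto
  then obtain d where d: "d > 0"
    "\<And>u v. u \<in> {-1..2} \<Longrightarrow> v \<in> {-1..2} \<Longrightarrow> \<bar>u - v\<bar> < d \<Longrightarrow>
      \<bar>(\<Phi> ^^ Suc R) u - (\<Phi> ^^ Suc R) v\<bar> < \<epsilon>"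
    using assms unfolding uniformly_continuous_on_def dist_real_def by metis
  have "\<bar>(\<Phi> ^^ Suc R) u - (\<Phi> ^^ Suc R) v\<bar> < \<epsilon>" if "\<bar>u - v\<bar> < min d 1" for u v
  proof -
    \<comment> \<open>One common integer translation brings both points into the compact interval.\<close>
    let ?m = "- \<lfloor>u\<rfloor>"
    have "u + of_int ?m \<in> {-1..2}" "v + of_int ?m \<in> {-1..2}"
      using that by (simp; linarith)+
    moreover have "\<bar>(u + of_int ?m) - (v + of_int ?m)\<bar> < d" using that by simp
    ultimately have
      "\<bar>(\<Phi> ^^ Suc R) (u + of_int ?m) - (\<Phi> ^^ Suc R) (v + of_int ?m)\<bar> < \<epsilon>" by (rule d(2))
    then show ?thesis unfolding it.shift_int by simp
  qed
  with \<delta> d(1) show ?case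
    by (intro exI[of _ "min \<delta> (min d 1)"]) (auto simp: le_Suc_eq simp del: funpow.simps)
qed

text \<open>Passing to \<open>F = \<Phi>\<^sup>q - p\<close> thins an orbit \<open>X\<close> to the \<open>F\<close>-orbit \<open>k \<mapsto> X (k q) - k p\<close>.
  The other residues of the index modulo \<open>q\<close> are reached from it by one of finitely many
  iterates of \<open>\<Phi>\<close>, so that they settle in the same time direction.\<close>

lemma orbit_almost_periodic_forward_or_backward:
  assumes fp: "(\<Phi> ^^ q) w0 = w0 + of_int p" and q: "q > 0" and "\<epsilon> > 0"
  shows "\<exists>N::nat. \<forall>X. is_orbit \<Phi> X \<longrightarrow>
    (\<forall>i\<ge>int N. \<forall>l::nat. \<bar>X (i + int (l * q)) - X i - of_int (int l * p)\<bar> < \<epsilon>) \<or>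
    (\<forall>i\<le>0. \<forall>l::nat. \<bar>X (i - int (l * q)) - X i + of_int (int l * p)\<bar> < \<epsilon>)"
proof -
  obtain \<delta> where \<delta>: "\<delta> > 0"
    "\<And>r u v. r \<le> q \<Longrightarrow> \<bar>u - v\<bar> < \<delta> \<Longrightarrow> \<bar>(\<Phi> ^^ r) u - (\<Phi> ^^ r) v\<bar> < \<epsilon>"
    using iterates_equicontinuous[OF \<open>\<epsilon> > 0\<close>] by meson
  interpret it: degree_one_lift "\<Phi> ^^ q" by (rule iterate)
  interpret F: degree_one_lift "\<lambda>x. (\<Phi> ^^ q) x + - of_int p" by (rule it.translate)
  obtain K where K: "\<And>Y. is_orbit (\<lambda>x. (\<Phi> ^^ q) x + - of_int p) Y \<Longrightarrow>
    (\<forall>k\<ge>int K. \<forall>l::nat. \<bar>Y (k + int l) - Y k\<bar> < \<delta>) \<or>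
    (\<forall>k\<le>0. \<forall>l::nat. \<bar>Y (k - int l) - Y k\<bar> < \<delta>)"
    using F.orbit_settles_forward_or_backward[of w0, OF _ \<delta>(1)] fp by auto
  have "(\<forall>i\<ge>int (K * q). \<forall>l::nat. \<bar>X (i + int (l * q)) - X i - of_int (int l * p)\<bar> < \<epsilon>) \<or>
    (\<forall>i\<le>0. \<forall>l::nat. \<bar>X (i - int (l * q)) - X i + of_int (int l * p)\<bar> < \<epsilon>)"
    if X: "is_orbit \<Phi> X" for X
  proof -
    define Y where "Y k = X (k * int q) - of_int (k * p)" for k
    have "is_orbit (\<lambda>x. (\<Phi> ^^ q) x + - of_int p) Y"
      unfolding is_orbit_def
    proof
      fix k
      have "X ((k + 1) * int q) = (\<Phi> ^^ q) (X (k * int q))"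
        using orbit_iterate[OF X, of "k * int q" q] by (simp add: algebra_simps)
      also have "\<dots> = (\<Phi> ^^ q) (Y k) + of_int (k * p)"
        using it.shift_int[of "Y k" "k * p"] by (simp add: Y_def)
      finally show "Y (k + 1) = (\<Phi> ^^ q) (Y k) + - of_int p"
        unfolding Y_def[of "k + 1"] by (simp add: algebra_simps)
    qed
    note dichotomy = K[OF this]
    have X_from_Y: "X (i + l * int q) =
      (\<Phi> ^^ nat (i mod int q)) (Y (i div int q + l)) + of_int ((i div int q + l) * p)" for i l
    proof -
      let ?r = "nat (i mod int q)" and ?k = "i div int q + l"
      interpret r: degree_one_lift "\<Phi> ^^ ?r" by (rule iterate)
      have "i + l * int q = ?k * int q + int ?r"
        using q by (simp add: algebra_simps)
      then have "X (i + l * int q) = (\<Phi> ^^ ?r) (X (?k * int q))"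
        using orbit_iterate[OF X] by metis
      also have "X (?k * int q) = Y ?k + of_int (?k * p)" by (simp add: Y_def)
      finally show ?thesis unfolding r.shift_int .
    qed
    have diff: "X (i + l * int q) - X i - of_int (l * p) =
      (\<Phi> ^^ nat (i mod int q)) (Y (i div int q + l)) - (\<Phi> ^^ nat (i mod int q)) (Y (i div int q))"
      for i l
      using X_from_Y[of i l] X_from_Y[of i 0] by (simp add: algebra_simps)
    have r: "nat (i mod int q) \<le> q" for i
      using q by (simp add: nat_le_iff less_imp_le)
    from dichotomy show ?thesis
    proof
      assume *: "\<forall>k\<ge>int K. \<forall>l::nat. \<bar>Y (k + int l) - Y k\<bar> < \<delta>"
      have "\<bar>X (i + int (l * q)) - X i - of_int (int l * p)\<bar> < \<epsilon>" if "i \<ge> int (K * q)" for i l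
      proof -
        have "int K \<le> i div int q"
          using zdiv_mono1[OF that, of "int q"] q by simp
        with * \<delta>(2)[OF r] have "\<bar>X (i + int l * int q) - X i - of_int (int l * p)\<bar> < \<epsilon>"
          unfolding diff by blast
        then show ?thesis by simp
      qed
      then show ?thesis by blast
    next
      assume *: "\<forall>k\<le>0. \<forall>l::nat. \<bar>Y (k - int l) - Y k\<bar> < \<delta>"
      have "\<bar>X (i - int (l * q)) - X i + of_int (int l * p)\<bar> < \<epsilon>" if "i \<le> 0" for i l
      proof -
        have "i div int q \<le> 0"
          using zdiv_mono1[OF that, of "int q"] q by simp
        with * have "\<bar>Y (i div int q + - int l) - Y (i div int q)\<bar> < \<delta>" by simp
        with \<delta>(2)[OF r] have "\<bar>X (i + - int l * int q) - X i - of_int (- int l * p)\<bar> < \<epsilon>"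
          unfolding diff by blast
        then show ?thesis by simp
      qed
      then show ?thesis by blast
    qed
  qed
  then show ?thesis by blast
qed

section \<open>The translation number of a lift\<close>

text \<open>As the displacement of \<open>\<Phi>\<^sup>n\<close> oscillates by at most 1, \<open>\<Phi>\<^bsup>m n\<^esup> 0\<close> differs from
  \<open>m \<Phi>\<^sup>n 0\<close> by at most \<open>m\<close>. Hence the averages at times \<open>n\<close> and \<open>m n\<close> differ by at most \<open>1 / n\<close>.\<close>

lemma translation_number_exists: "\<exists>L. \<forall>x. (\<lambda>n. (\<Phi> ^^ n) x / real n) \<longlonglongrightarrow> L"
proof -
  define a where "a n = (\<Phi> ^^ n) 0" for n
  have osc: "\<bar>(\<Phi> ^^ n) x - x - a n\<bar> \<le> 1" for n x
    using degree_one_lift.displacement_oscillation[OF iterate, of n x 0] by (simp add: a_def)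
  have quasi_linear: "\<bar>a (m * n) - real m * a n\<bar> \<le> real m" for m n
  proof (induction m)
    case (Suc m)
    have "a (Suc m * n) = (\<Phi> ^^ n) (a (m * n))" by (simp add: a_def funpow_add)
    with osc[of n "a (m * n)"] Suc show ?case by (simp add: algebra_simps)
  qed (simp add: a_def)
  have approx: "\<bar>a (m * n) / real (m * n) - a n / real n\<bar> \<le> 1 / real n" if "m > 0" "n > 0" for m n
  proof -
    have "a (m * n) / real (m * n) - a n / real n = (a (m * n) - real m * a n) / real (m * n)"
      using that by (simp add: field_simps)
    also have "\<bar>\<dots>\<bar> \<le> real m / real (m * n)"
      by (simp only: abs_divide abs_of_nat divide_right_mono of_nat_0_le_iff quasi_linear)
    finally show ?thesis using that by simp
  qed
  have "Cauchy (\<lambda>n. a n / real n)"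
  proof (rule metric_CauchyI)
    fix e :: real assume "e > 0"
    obtain M :: nat where M: "2 / e < real M" using reals_Archimedean2 by blast
    have "M > 0" using M \<open>e > 0\<close> by (intro gr0I) (simp add: divide_less_0_iff)
    have small: "1 / real n < e / 2" if "n \<ge> M" for n
    proof -
      have "2 / e < real n" using M that by linarith
      then show ?thesis using \<open>e > 0\<close> \<open>M > 0\<close> that by (simp add: field_simps)
    qed
    have "dist (a m / real m) (a n / real n) < e" if "m \<ge> M" "n \<ge> M" for m n
      \<comment> \<open>Both quotients are compared with the one at time \<open>m n\<close>.\<close>
      using approx[of m n] approx[of n m] small[of m] small[of n] that \<open>M > 0\<close>
      by (simp add: dist_real_def mult.commute)
    then show "\<exists>M. \<forall>m\<ge>M. \<forall>n\<ge>M. dist (a m / real m) (a n / real n) < e" by blast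
  qed
  then obtain L where L: "(\<lambda>n. a n / real n) \<longlonglongrightarrow> L"
    using Cauchy_convergent convergent_def by blast
  have "(\<lambda>n. (\<Phi> ^^ n) x / real n) \<longlonglongrightarrow> L" for x
  proof -
    have "(\<lambda>n. (\<Phi> ^^ n) x / real n - a n / real n) \<longlonglongrightarrow> 0"
    proof (rule Lim_null_comparison)
      show "\<forall>\<^sub>F n in sequentially.
        norm ((\<Phi> ^^ n) x / real n - a n / real n) \<le> (\<bar>x\<bar> + 1) / real n"
      proof (intro always_eventually allI)
        fix n
        have "\<bar>(\<Phi> ^^ n) x - a n\<bar> \<le> \<bar>x\<bar> + 1" using osc[of n x] by linarith
        then show "norm ((\<Phi> ^^ n) x / real n - a n / real n) \<le> (\<bar>x\<bar> + 1) / real n"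
          by (simp add: diff_divide_distrib[symmetric] abs_divide divide_right_mono)
      qed
      show "(\<lambda>n. (\<bar>x\<bar> + 1) / real n) \<longlonglongrightarrow> 0" by (rule lim_const_over_n)
    qed
    from tendsto_add[OF this L] show ?thesis by simp
  qed
  then show ?thesis by blast
qed

text \<open>Without fixed points the displacement is bounded away from 0 and keeps its sign, so that
  every orbit drifts with at least linear speed.\<close>

lemma zero_translation_number_fixed_point:
  assumes lim: "(\<lambda>n. (\<Phi> ^^ n) x / real n) \<longlonglongrightarrow> 0"
  shows "\<exists>w. \<Phi> w = w"
proof (rule ccontr)
  assume nofp: "\<not> ?thesis"
  with small_displacement_near_fixed_point[of 1]
  obtain c where c: "c > 0" "\<And>y. c \<le> \<bar>\<Phi> y - y\<bar>" by (auto simp: not_less[symmetric])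
  have "connected (range (\<lambda>y. \<Phi> y - y))"
    by (intro connected_continuous_image continuous_intros cont) simp
  moreover have "0 \<notin> range (\<lambda>y. \<Phi> y - y)" using nofp by auto
  ultimately have sign: "(\<forall>y. \<Phi> y - y > 0) \<or> (\<forall>y. \<Phi> y - y < 0)"
    unfolding connected_iff_interval by (smt (verit, best) rangeE rangeI)
  have limx: "(\<lambda>n. ((\<Phi> ^^ n) x - x) / real n) \<longlonglongrightarrow> 0"
    using tendsto_diff[OF lim lim_const_over_n[of x]] by (simp add: diff_divide_distrib)
  from sign show False
  proof
    assume pos: "\<forall>y. \<Phi> y - y > 0"
    have "real n * c \<le> (\<Phi> ^^ n) x - x" for n
    proof (induction n)
      case (Suc n)
      then show ?case using c(2)[of "(\<Phi> ^^ n) x"] pos[rule_format, of "(\<Phi> ^^ n) x"]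
        by (simp add: algebra_simps)
    qed simp
    then have "c \<le> ((\<Phi> ^^ n) x - x) / real n" if "n \<ge> 1" for n
      using that by (simp add: field_simps)
    then have "c \<le> 0" by (intro LIMSEQ_le_const[OF limx]) blast
    with c(1) show False by simp
  next
    assume neg: "\<forall>y. \<Phi> y - y < 0"
    have "(\<Phi> ^^ n) x - x \<le> - real n * c" for n
    proof (induction n)
      case (Suc n)
      then show ?case using c(2)[of "(\<Phi> ^^ n) x"] neg[rule_format, of "(\<Phi> ^^ n) x"]
        by (simp add: algebra_simps)
    qed simp
    then have "((\<Phi> ^^ n) x - x) / real n \<le> - c" if "n \<ge> 1" for n
      using that by (simp add: field_simps)
    then have "0 \<le> - c" by (intro LIMSEQ_le_const2[OF limx]) blast
    with c(1) show False by simp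
  qed
qed

lemma rational_translation_number_periodic_point:
  assumes lim: "(\<lambda>n. (\<Phi> ^^ n) x / real n) \<longlonglongrightarrow> of_int p / real q" and q: "q > 0"
  shows "\<exists>w. (\<Phi> ^^ q) w = w + of_int p"
proof -
  interpret it: degree_one_lift "\<Phi> ^^ q" by (rule iterate)
  let ?F = "\<lambda>x. (\<Phi> ^^ q) x + - of_int p"
  interpret F: degree_one_lift ?F by (rule it.translate)
  have F_iter: "(?F ^^ n) x = (\<Phi> ^^ (n * q)) x - of_int (int n * p)" for n
  proof (induction n)
    case (Suc n)
    have "(?F ^^ Suc n) x = (\<Phi> ^^ q) ((\<Phi> ^^ (n * q)) x + of_int (- (int n * p))) - of_int p"
      using Suc by simp
    also have "\<dots> = (\<Phi> ^^ q) ((\<Phi> ^^ (n * q)) x) - of_int (int (Suc n) * p)"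
      unfolding it.shift_int by (simp add: algebra_simps)
    finally show ?case by (simp add: funpow_add)
  qed simp
  have "filterlim (\<lambda>n. n * q) sequentially sequentially"
    using q by (intro filterlim_subseq) (auto simp: strict_mono_def)
  from filterlim_compose[OF lim this]
  have "(\<lambda>n. real q * ((\<Phi> ^^ (n * q)) x / real (n * q)) - of_int p) \<longlonglongrightarrow>
      real q * (of_int p / real q) - of_int p"
    by (intro tendsto_diff tendsto_mult tendsto_const)
  then have "(\<lambda>n. real q * ((\<Phi> ^^ (n * q)) x / real (n * q)) - of_int p) \<longlonglongrightarrow> 0"
    using q by simp
  moreover have "\<forall>\<^sub>F n in sequentially.
      real q * ((\<Phi> ^^ (n * q)) x / real (n * q)) - of_int p = (?F ^^ n) x / real n"
    using eventually_gt_at_top[of 0]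
    by eventually_elim (unfold F_iter, use q in \<open>simp add: field_simps\<close>)
  ultimately have "(\<lambda>n. (?F ^^ n) x / real n) \<longlonglongrightarrow> 0"
    by (rule Lim_transform_eventually)
  from F.zero_translation_number_fixed_point[OF this] obtain w where "(\<Phi> ^^ q) w + - of_int p = w"
    by blast
  then have "(\<Phi> ^^ q) w = w + of_int p" by simp
  then show ?thesis ..
qed

lemma translate_iterate:
  "((\<lambda>x. \<Phi> x + of_int k) ^^ n) x = (\<Phi> ^^ n) x + of_int (int n * k)"
proof (induction n)
  case (Suc n)
  then show ?case using shift_int[of "(\<Phi> ^^ n) x" "int n * k"] by (simp add: algebra_simps)
qed simp

end

section \<open>Lifts of a circle homeomorphism\<close>

lemma circle_cover_eq_iff: "circle_cover x = circle_cover y \<longleftrightarrow> (\<exists>m::int. x = y + of_int m)"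
proof -
  have "(2 * of_real pi * \<i> * of_real x = 2 * of_real pi * \<i> * of_real y +
      (of_int (2 * m) * pi) * \<i>) \<longleftrightarrow> x = y + of_int m" for m :: int
  proof -
    have "2 * of_real pi * \<i> * of_real y + (of_int (2 * m) * pi) * \<i> =
      2 * of_real pi * \<i> * of_real (y + of_int m)" by (simp add: algebra_simps)
    then show ?thesis by (simp del: of_real_add)
  qed
  then show ?thesis unfolding circle_cover_def exp_eq by simp
qed

lemma circle_cover_in_sphere: "circle_cover x \<in> sphere 0 1"
  by (simp add: circle_cover_def)

lemma circle_cover_surj:
  assumes "z \<in> sphere 0 1"
  obtains x where "z = circle_cover x"
proof -
  from assms have "z = exp (\<i> * of_real (Arg z))"
    using Arg_eq[of z] by (cases "z = 0") auto
  then have "z = circle_cover (Arg z / (2 * pi))"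
    by (simp add: circle_cover_def mult_ac)
  with that show ?thesis by blast
qed

lemma continuous_integer_valued_constant:
  fixes f :: "real \<Rightarrow> real"
  assumes "continuous_on UNIV f" "\<And>x. f x \<in> \<int>"
  shows "\<exists>m::int. \<forall>x. f x = of_int m"
proof -
  have "f constant_on UNIV"
  proof (rule continuous_discrete_range_constant[OF _ assms(1)])
    fix x
    have "1 \<le> norm (f y - f x)" if "f y \<noteq> f x" for y
      using that assms(2) by (metis Ints_diff Ints_nonzero_abs_ge1 eq_iff_diff_eq_0 real_norm_def)
    then show "\<exists>e>0. \<forall>y. y \<in> UNIV \<and> f y \<noteq> f x \<longrightarrow> e \<le> norm (f y - f x)"
      by (intro exI[of _ 1]) auto
  qed simp
  then obtain c where "\<And>x. f x = c" by (auto simp: constant_on_def)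
  with assms(2) show ?thesis by (metis Ints_cases)
qed

lemma lifts_differ_by_integer:
  assumes "is_lift \<phi> \<Phi>" "is_lift \<phi> \<Psi>"
  obtains k :: int where "\<Psi> = (\<lambda>x. \<Phi> x + of_int k)"
proof -
  have cont: "continuous_on UNIV (\<lambda>x. \<Psi> x - \<Phi> x)"
    using assms by (auto simp: is_lift_def intro!: continuous_intros)
  have int: "\<Psi> x - \<Phi> x \<in> \<int>" for x
  proof -
    have "circle_cover (\<Psi> x) = circle_cover (\<Phi> x)" using assms by (simp add: is_lift_def)
    then show ?thesis by (auto simp: circle_cover_eq_iff)
  qed
  obtain k :: int where "\<forall>x. \<Psi> x - \<Phi> x = of_int k"
    using continuous_integer_valued_constant[OF cont int] by blast
  then have "\<Psi> = (\<lambda>x. \<Phi> x + of_int k)" by (auto simp: algebra_simps)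
  with that show ?thesis by blast
qed

text \<open>The increment of an increasing lift over a unit interval is a positive integer. It equals 1
  because a larger increment would force two points of the circle to have the same image.\<close>

lemma degree_one_lift_exists:
  assumes "orientation_preserving_circle_homeo \<phi>"
  obtains \<Phi> where "is_lift \<phi> \<Phi>" "degree_one_lift \<Phi>"
proof -
  from assms obtain \<psi> \<Phi> where hom: "homeomorphism (sphere 0 1) (sphere 0 1) \<phi> \<psi>"
    and lift: "is_lift \<phi> \<Phi>" and sm: "strict_mono \<Phi>"
    unfolding orientation_preserving_circle_homeo_def by blast
  have cont: "continuous_on UNIV \<Phi>" and sc: "circle_cover (\<Phi> x) = \<phi> (circle_cover x)" for x
    using lift by (auto simp: is_lift_def)
  have "is_lift \<phi> (\<lambda>x. \<Phi> (x + 1))"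
    unfolding is_lift_def
  proof (intro conjI allI)
    show "continuous_on UNIV (\<lambda>x. \<Phi> (x + 1))"
      by (rule continuous_on_compose2[OF cont]) (auto intro!: continuous_intros)
    have "circle_cover (x + 1) = circle_cover x" for x
      unfolding circle_cover_eq_iff by (rule exI[of _ 1]) simp
    then show "circle_cover (\<Phi> (x + 1)) = \<phi> (circle_cover x)" for x using sc by simp
  qed
  from lifts_differ_by_integer[OF lift this] obtain d :: int
    where d: "\<And>x. \<Phi> (x + 1) = \<Phi> x + of_int d" by metis
  have "\<Phi> 0 < \<Phi> 1" using sm by (simp add: strict_mono_def)
  then have "d > 0" using d[of 0] by simp
  have "d = 1"
  proof (rule ccontr)
    assume "d \<noteq> 1"
    with \<open>d > 0\<close> have "real_of_int d \<ge> 2" by linarith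
    then have "\<Phi> 0 \<le> \<Phi> 0 + 1" "\<Phi> 0 + 1 \<le> \<Phi> 1" using d[of 0] by auto
    then obtain y where y: "0 \<le> y" "y \<le> 1" "\<Phi> y = \<Phi> 0 + 1"
      using IVT'[of \<Phi> 0 "\<Phi> 0 + 1" 1] continuous_on_subset[OF cont] by auto
    have "circle_cover (\<Phi> y) = circle_cover (\<Phi> 0)"
      unfolding circle_cover_eq_iff y by (rule exI[of _ 1]) simp
    then have "\<phi> (circle_cover y) = \<phi> (circle_cover 0)" by (simp add: sc)
    then have "circle_cover y = circle_cover 0"
      using hom circle_cover_in_sphere by (metis homeomorphism_apply1)
    then obtain m :: int where m: "y = of_int m" by (auto simp: circle_cover_eq_iff)
    with y have "m = 0 \<or> m = 1" by auto
    with m y(3) d[of 0] \<open>real_of_int d \<ge> 2\<close> show False by auto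
  qed
  with d cont sm have "degree_one_lift \<Phi>" by unfold_locales auto
  with lift that show ?thesis by blast
qed

text \<open>Replacing the lift \<open>\<Phi>\<close> by \<open>\<Phi> + k\<close> turns \<open>L\<close> into \<open>L + k\<close>, so that the value described in the
  definition is unique.\<close>

lemma rotation_number_eq:
  assumes lift: "is_lift \<phi> \<Phi>" and deg: "degree_one_lift \<Phi>"
    and lim: "\<And>x. (\<lambda>n. (\<Phi> ^^ n) x / real n) \<longlonglongrightarrow> L"
  shows "rotation_number \<phi> = frac L"
  unfolding rotation_number_def
proof (rule the_equality)
  show "\<exists>\<Phi> x L'. is_lift \<phi> \<Phi> \<and> (\<lambda>n. (\<Phi> ^^ n) x / real n) \<longlonglongrightarrow> L' \<and> frac L = frac L'"
    using lift lim by blast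
next
  interpret degree_one_lift \<Phi> by (rule deg)
  fix r
  assume "\<exists>\<Psi> x L'. is_lift \<phi> \<Psi> \<and> (\<lambda>n. (\<Psi> ^^ n) x / real n) \<longlonglongrightarrow> L' \<and> r = frac L'"
  then obtain \<Psi> x L' where \<Psi>: "is_lift \<phi> \<Psi>"
    and L': "(\<lambda>n. (\<Psi> ^^ n) x / real n) \<longlonglongrightarrow> L'" and r: "r = frac L'" by blast
  obtain k :: int where k: "\<Psi> = (\<lambda>x. \<Phi> x + of_int k)"
    using lifts_differ_by_integer[OF lift \<Psi>] .
  have "(\<lambda>n. (\<Phi> ^^ n) x / real n + of_int k) \<longlonglongrightarrow> L + of_int k"
    by (intro tendsto_intros lim)
  moreover have "\<forall>\<^sub>F n in sequentially.
      (\<Phi> ^^ n) x / real n + of_int k = (\<Psi> ^^ n) x / real n"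
    using eventually_gt_at_top[of 0]
    by eventually_elim (unfold k translate_iterate, simp add: field_simps)
  ultimately have "(\<lambda>n. (\<Psi> ^^ n) x / real n) \<longlonglongrightarrow> L + of_int k"
    by (rule Lim_transform_eventually)
  then have "L' = L + of_int k" using L' LIMSEQ_unique by blast
  then show "r = frac L" using r by (simp add: frac_def)
qed

text \<open>Over the same point of the circle, the orbit of the lift \<open>\<Phi> + k\<close> starting at \<open>x + m\<close> is
  \<open>X i + m + i k\<close>. Its steps differ from those of \<open>X\<close> by the integer \<open>k\<close>.\<close>

lemma displacement_eq:
  assumes lift: "is_lift \<phi> \<Phi>" and deg: "degree_one_lift \<Phi>"
    and X: "is_orbit \<Phi> X" "X 0 = x"
  shows "displacement \<phi> n (circle_cover x) = frac (X n - X (n - 1))"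
  unfolding displacement_def
proof (rule the_equality)
  interpret degree_one_lift \<Phi> by (rule deg)
  have "(\<lambda>i. int_iterate \<Phi> i x) = X"
    using X by (intro orbit_unique[OF int_iterate_orbit[OF bijective]])
      (auto simp: int_iterate_def bij_is_inj[OF bijective])
  then have "\<And>i. int_iterate \<Phi> i x = X i" by metis
  then show "\<exists>\<Phi> y. is_lift \<phi> \<Phi> \<and> circle_cover x = circle_cover y \<and>
      frac (X n - X (n - 1)) = frac (int_iterate \<Phi> n y - int_iterate \<Phi> (n - 1) y)"
    using lift by metis
next
  interpret degree_one_lift \<Phi> by (rule deg)
  fix r
  assume "\<exists>\<Psi> y. is_lift \<phi> \<Psi> \<and> circle_cover x = circle_cover y \<and>
      r = frac (int_iterate \<Psi> n y - int_iterate \<Psi> (n - 1) y)"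
  then obtain \<Psi> y where \<Psi>: "is_lift \<phi> \<Psi>" and y: "circle_cover y = circle_cover x"
    and r: "r = frac (int_iterate \<Psi> n y - int_iterate \<Psi> (n - 1) y)" by auto
  obtain k :: int where k: "\<Psi> = (\<lambda>x. \<Phi> x + of_int k)"
    using lifts_differ_by_integer[OF lift \<Psi>] .
  from y obtain m :: int where m: "y = x + of_int m" unfolding circle_cover_eq_iff by blast
  interpret \<Psi>: degree_one_lift \<Psi> unfolding k by (rule translate)
  have "is_orbit \<Psi> (\<lambda>i. X i + of_int (m + i * k))"
    using X(1) unfolding is_orbit_def k shift_int by (simp add: algebra_simps)
  then have "(\<lambda>i. int_iterate \<Psi> i y) = (\<lambda>i. X i + of_int (m + i * k))"
    using X(2) m by (intro orbit_unique[OF int_iterate_orbit[OF \<Psi>.bijective]])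
      (auto simp: int_iterate_def bij_is_inj[OF \<Psi>.bijective])
  then have "\<And>i. int_iterate \<Psi> i y = X i + of_int (m + i * k)" by metis
  then have "int_iterate \<Psi> n y - int_iterate \<Psi> (n - 1) y = X n - X (n - 1) + of_int k"
    by (simp add: algebra_simps)
  then show "r = frac (X n - X (n - 1))" unfolding r by (simp add: frac_def)
qed

section \<open>Uniform asymptotic periodicity of displacement sequences\<close>

theorem proposition2p10:
  fixes \<phi> :: "complex \<Rightarrow> complex" and p :: int and q :: nat
  assumes "orientation_preserving_circle_homeo \<phi>"
    and "q > 0"
    and "rotation_number \<phi> = real_of_int p / real q"
  shows "\<forall>\<epsilon>>0. \<exists>N::nat. \<forall>z \<in> sphere 0 1.
    (\<forall>n>N. \<forall>l::nat. \<bar>displacement \<phi> (int (n + l * q)) z - displacement \<phi> (int n) z\<bar> < \<epsilon>) \<or>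
    (\<forall>n>N. \<forall>l::nat. \<bar>displacement \<phi> (- int (n + l * q)) z - displacement \<phi> (- int n) z\<bar> < \<epsilon>)"
proof (intro allI impI)
  fix \<epsilon> :: real assume "\<epsilon> > 0"
  obtain \<Phi> where lift: "is_lift \<phi> \<Phi>" and deg: "degree_one_lift \<Phi>"
    using degree_one_lift_exists[OF assms(1)] .
  interpret degree_one_lift \<Phi> by (rule deg)
  obtain L where L: "\<And>x. (\<lambda>n. (\<Phi> ^^ n) x / real n) \<longlonglongrightarrow> L"
    using translation_number_exists by blast
  \<comment> \<open>The translation number of the chosen lift is only congruent to \<open>p / q\<close> modulo 1.\<close>
  define p' where "p' = p + \<lfloor>L\<rfloor> * int q"
  have "frac L = of_int p / real q" using rotation_number_eq[OF lift deg L] assms(3) by simp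
  then have "L = of_int p' / real q" using assms(2) by (simp add: frac_def p'_def field_simps)
  then obtain w where w: "(\<Phi> ^^ q) w = w + of_int p'"
    using rational_translation_number_periodic_point L assms(2) by blast
  obtain N :: nat where N: "\<And>X. is_orbit \<Phi> X \<Longrightarrow>
    (\<forall>i\<ge>int N. \<forall>l::nat. \<bar>X (i + int (l * q)) - X i - of_int (int l * p')\<bar> < \<epsilon> / 2) \<or>
    (\<forall>i\<le>0. \<forall>l::nat. \<bar>X (i - int (l * q)) - X i + of_int (int l * p')\<bar> < \<epsilon> / 2)"
    using orbit_almost_periodic_forward_or_backward[OF w assms(2), of "\<epsilon> / 2"] \<open>\<epsilon> > 0\<close>
    by auto
  show "\<exists>N::nat. \<forall>z \<in> sphere 0 1.
    (\<forall>n>N. \<forall>l::nat. \<bar>displacement \<phi> (int (n + l * q)) z - displacement \<phi> (int n) z\<bar> < \<epsilon>) \<or>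
    (\<forall>n>N. \<forall>l::nat. \<bar>displacement \<phi> (- int (n + l * q)) z - displacement \<phi> (- int n) z\<bar> < \<epsilon>)"
  proof (intro exI[of _ N] ballI)
    fix z :: complex assume "z \<in> sphere 0 1"
    then obtain x where x: "z = circle_cover x" by (rule circle_cover_surj)
    define X where "X i = int_iterate \<Phi> i x" for i
    have X: "is_orbit \<Phi> X" "X 0 = x"
      unfolding X_def using int_iterate_orbit[OF bijective] by (auto simp: int_iterate_def)
    have disp_diff: "displacement \<phi> i z - displacement \<phi> j z =
        (X i - X j) - (X (i - 1) - X (j - 1))" for i j
      using orbit_floor_step[OF X(1), of "i - 1" "j - 1"]
      by (simp add: x displacement_eq[OF lift deg X] frac_def)
    show "(\<forall>n>N. \<forall>l::nat. \<bar>displacement \<phi> (int (n + l * q)) z - displacement \<phi> (int n) z\<bar> < \<epsilon>) \<or>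
      (\<forall>n>N. \<forall>l::nat. \<bar>displacement \<phi> (- int (n + l * q)) z - displacement \<phi> (- int n) z\<bar> < \<epsilon>)"
      using N[OF X(1)]
    proof
      assume *: "\<forall>i\<ge>int N. \<forall>l::nat.
        \<bar>X (i + int (l * q)) - X i - of_int (int l * p')\<bar> < \<epsilon> / 2"
      have "\<bar>displacement \<phi> (int (n + l * q)) z - displacement \<phi> (int n) z\<bar> < \<epsilon>"
        if "n > N" for n l
      proof -
        have idx: "int n + int (l * q) = int (n + l * q)"
          "int n - 1 + int (l * q) = int (n + l * q) - 1" by simp_all
        have "int N \<le> int n" "int N \<le> int n - 1" using that by simp_all
        from this[THEN *[rule_format, of _ l]] show ?thesis
          unfolding disp_diff idx by linarith
      qed
      then show ?thesis by blast
    next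
      assume *: "\<forall>i\<le>0. \<forall>l::nat.
        \<bar>X (i - int (l * q)) - X i + of_int (int l * p')\<bar> < \<epsilon> / 2"
      have "\<bar>displacement \<phi> (- int (n + l * q)) z - displacement \<phi> (- int n) z\<bar> < \<epsilon>" for n l
      proof -
        have idx: "- int n - int (l * q) = - int (n + l * q)"
          "- int n - 1 - int (l * q) = - int (n + l * q) - 1" by simp_all
        have "- int n \<le> 0" "- int n - 1 \<le> 0" by simp_all
        from this[THEN *[rule_format, of _ l]] show ?thesis
          unfolding disp_diff idx by linarith
      qed
      then show ?thesis by blast
    qed
  qed
qed

end
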